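(* In the timed process algebra T-AWN, let $P$ be a state of a sequential process. Write $P\xrightarrow{\mathbf{rcv}}$ if $P\xrightarrow{\mathbf{receive}(m)}$ for some $m\in\mathrm{MSG}$, $P\xrightarrow{\mathbf{send}}$ if $P\xrightarrow{\mathbf{send}(m)}$ for some $m\in\mathrm{MSG}$, and $P\xrightarrow{\mathbf{other}}$ if $P\xrightarrow{a}$ for some action $a$ that is neither of the form $\mathbf{receive}(m)$, nor of the form $\mathbf{send}(m)$, nor a wait action in $\mathcal{W}$ (so transmission actions $R{:}w_1$ count as "other"). Then: 1. $P\xrightarrow{\mathrm{w}}$ iff $P\not\xrightarrow{\mathbf{rcv}}\wedge P\not\xrightarrow{\mathbf{send}}\wedge P\not\xrightarrow{\mathbf{other}}$. 2. $P\xrightarrow{\mathrm{wr}}$ iff $P\xrightarrow{\mathbf{rcv}}\wedge P\not\xrightarrow{\mathbf{send}}\wedge P\not\xrightarrow{\mathbf{other}}$. 3. $P\xrightarrow{\mathrm{ws}}$ iff $P\not\xrightarrow{\mathbf{rcv}}\wedge P\xrightarrow{\mathbf{send}}\wedge P\not\xrightarrow{\mathbf{other}}$. 4. $P\xrightarrow{\mathrm{wrs}}$ iff $P\xrightarrow{\mathbf{rcv}}\wedge P\xrightarrow{\mathbf{send}}\wedge P\not\xrightarrow{\mathbf{other}}$.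
   Context: $P\xrightarrow{a}$ means that there exists $P'$ with $P\xrightarrow{a}P'$. States may contain the auxiliary construct $\mathbf{*cast}$, but never inside a $+$-context. T-AWN sequential processes. A data structure is fixed with types including TIME (integers, together with $\infty$), DATA, MSG, IP and $\mathcal{P}(\mathrm{IP})$, and with data expressions and first-order formulas over it (partial functions are allowed; an atomic formula containing an undefined subterm is false). A valuation $\xi$ is a partial map from variables to values; $\xi(e)\!\downarrow$ means that expression $e$ is defined under $\xi$. $\xi[\mathtt{var}:=v]$ agrees with $\xi$ except that it maps $\mathtt{var}$ to $v$; $\emptyset$ is the empty valuation. There is a distinguished variable $\mathtt{now}$ of type TIME, and $\xi[\mathtt{now}{+}{+}]:=\xi[\mathtt{now}:=\xi(\mathtt{now})+1]$. Each process name $X$ has a defining equation $X(\mathtt{var}_1,\dots,\mathtt{var}_n)\stackrel{def}{=}p$ with $p$ guarded, i.e. every call of a process name in $p$ occurs inside a subexpression $[\varphi]q$, $[\![\mathtt{var}:=e]\!]q$, $\alpha.q$ or $\mathbf{unicast}(dest,ms).q\blacktriangleright r$. Sequential process expressions: $SP::= X(e_1,\dots,e_n)\mid[\varphi]SP\mid[\![\mathtt{var}:=e]\!]SP\mid SP+SP\mid \alpha.SP\mid \mathbf{unicast}(dest,ms).SP\blacktriangleright SP\mid \mathbf{*cast}_{dsts}(m)[n,o].SP\blacktriangleright SP$ with $\alpha::=\mathbf{broadcast}(ms)\mid\mathbf{groupcast}(dests,ms)\mid\mathbf{send}(ms)\mid\mathbf{deliver}(data)\mid\mathbf{receive}(\mathtt{msg})$.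 In the last construct $m\in\mathrm{MSG}$, $n,o\in\mathbb{N}$, $dsts\subseteq\mathrm{IP}$. Constants $LB,LG,LU>0$ and $\Delta B,\Delta G,\Delta U\ge 0$ are fixed. A state is a pair $\xi,p$. Actions are $\tau$, $R{:}\mathbf{*cast}(m)$, $\mathbf{send}(m)$, $\mathbf{deliver}(d)$, $\mathbf{receive}(m)$, wait actions $w_1\in\mathcal{W}=\{\mathrm{w},\mathrm{wr},\mathrm{ws},\mathrm{wrs}\}$, and transmission actions $R{:}w_1$, for $R\subseteq\mathrm{IP}$. The join $\wedge$ on $\mathcal{W}$ is defined by: $\mathrm{w}\wedge x=x\wedge\mathrm{w}=x$, $x\wedge x=x$, $\mathrm{wr}\wedge\mathrm{ws}=\mathrm{ws}\wedge\mathrm{wr}=\mathrm{wrs}$, and $\mathrm{wrs}\wedge x=x\wedge\mathrm{wrs}=\mathrm{wrs}$. The transition relation is the least relation closed under the following rules. - Broadcast: $\xi,\mathbf{broadcast}(ms).p\xrightarrow{\tau}\xi,\mathbf{*cast}_{\mathrm{IP}}(\xi(ms))[LB,\Delta B].p\blacktriangleright p$ if $\xi(ms)\!\downarrow$. - Groupcast: likewise to $\mathbf{*cast}_{\xi(dests)}(\xi(ms))[LG,\Delta G].p\blacktriangleright p$. - Unicast: $\xi,\mathbf{unicast}(dest,ms).p\blacktriangleright q\xrightarrow{\tau}\xi,\mathbf{*cast}_{\{\xi(dest)\}}(\xi(ms))[LU,\Delta U].p\blacktriangleright q$ if defined. - Transmission steps, for every $R\subseteq\mathrm{IP}$: $\xi,\mathbf{*cast}_{dsts}(m)[n{+}1,o].p\blacktriangleright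 q\xrightarrow{R:\mathrm{w}}\xi[\mathtt{now}{+}{+}],\mathbf{*cast}_{dsts\cap R}(m)[n,o].p\blacktriangleright q$, and $\xi,\mathbf{*cast}_{dsts}(m)[n{+}1,o{+}1].p\blacktriangleright q\xrightarrow{R:\mathrm{w}}\xi[\mathtt{now}{+}{+}],\mathbf{*cast}_{dsts\cap R}(m)[n{+}1,o].p\blacktriangleright q$. - Completion: $\xi,\mathbf{*cast}_{dsts}(m)[0,o].p\blacktriangleright q\xrightarrow{dsts:\mathbf{*cast}(m)}\xi,p$ if $dsts\neq\emptyset$, and $\to\xi,q$ if $dsts=\emptyset$. - Send: if $\xi(ms)\!\downarrow$, then $\xi,\mathbf{send}(ms).p\xrightarrow{\mathbf{send}(\xi(ms))}\xi,p$ and $\xi,\mathbf{send}(ms).p\xrightarrow{\mathrm{ws}}\xi[\mathtt{now}{+}{+}],\mathbf{send}(ms).p$. - Deliver: $\xi,\mathbf{deliver}(data).p\xrightarrow{\mathbf{deliver}(\xi(data))}\xi,p$ if defined. - Receive: $\xi,\mathbf{receive}(\mathtt{msg}).p\xrightarrow{\mathbf{receive}(m)}\xi[\mathtt{msg}:=m],p$ for every $m\in\mathrm{MSG}$, and $\xi,\mathbf{receive}(\mathtt{msg}).p\xrightarrow{\mathrm{wr}}\xi[\mathtt{now}{+}{+}],\mathbf{receive}(\mathtt{msg}).p$. - Assignment: $\xi,[\![\mathtt{var}:=e]\!]p\xrightarrow{\tau}\xi[\mathtt{var}:=\xi(e)],p$ if $\xi(e)\!\downarrow$. - Stuck states: $\xi,r\xrightarrow{\mathrm{w}}\xi[\mathtt{now}{+}{+}],r$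 whenever $\xi,r$ is unvalued, i.e. $r$ is of the form $\mathbf{broadcast}(ms).p$, $\mathbf{groupcast}(dests,ms).p$, $\mathbf{unicast}(dest,ms).p\blacktriangleright q$, $\mathbf{send}(ms).p$, $\mathbf{deliver}(data).p$, $[\![\mathtt{var}:=e]\!]p$ or $X(e_1,\dots,e_n)$ with one of the displayed expressions undefined under $\xi$. - Recursion: if $X(\mathtt{var}_1,\dots,\mathtt{var}_n)\stackrel{def}{=}p$, all $\xi(e_i)\!\downarrow$, and $\emptyset[\mathtt{var}_i:=\xi(e_i)]_{i=1}^n,p\xrightarrow{a}\zeta,p'$, then: if $a\notin\mathcal{W}$, $\xi,X(e_1,\dots,e_n)\xrightarrow{a}\zeta,p'$; if $a=w_1\in\mathcal{W}$, $\xi,X(e_1,\dots,e_n)\xrightarrow{w_1}\xi[\mathtt{now}{+}{+}],X(e_1,\dots,e_n)$. - Guard: $\xi,[\varphi]p\xrightarrow{\tau}\zeta,p$ whenever $\zeta$ extends $\xi$ by assigning values only to the free variables of $\varphi$ undefined under $\xi$ and $\zeta$ satisfies $\varphi$; if no such $\zeta$ exists, $\xi,[\varphi]p\xrightarrow{\mathrm{w}}\xi[\mathtt{now}{+}{+}],[\varphi]p$. - Choice: if $\xi,p\xrightarrow{a}\zeta,p'$ with $a\notin\mathcal{W}$, then $\xi,p+q\xrightarrow{a}\zeta,p'$ and $\xi,q+p\xrightarrow{a}\zeta,p'$; if $\xi,p\xrightarrow{w_1}\zeta,p'$ and $\xi,q\xrightarrow{w_2}\zeta,q'$ with $w_1,w_2\in\mathcal{W}$,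 then $\xi,p+q\xrightarrow{w_1\wedge w_2}\zeta,p'+q'$. *)

theory Defs
  imports Main
begin

section \<open>Data structure\<close>

datatype time = Fin int | Infty

primrec time_succ :: "time \<Rightarrow> time" where
  "time_succ (Fin k) = Fin (k + 1)"
| "time_succ Infty = Infty"

text \<open>The five types every data structure has, and arbitrary further ones, indexed by \<open>'t\<close>.
  Messages, data and addresses are the elements of the HOL types \<open>'m\<close>, \<open>'d\<close>, \<open>'i\<close>;
  in particular, there is at least one message. Values of the further types live in \<open>'u\<close>.\<close>

datatype 't dtype = TIME | DATA | MSG | IP | IPSET | Other 't

datatype ('d, 'm, 'i, 'u) val =
  VTime time | VData 'd | VMsg 'm | VIP 'i | VIPs "'i set" | VOther 'u

datatype ('x, 'f) expr = Var 'x | Fn 'f "('x, 'f) expr list"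

datatype ('x, 'f, 'r) form =
    Eq "('x, 'f) expr" "('x, 'f) expr"
  | Rel 'r "('x, 'f) expr list"
  | Neg "('x, 'f, 'r) form"
  | Conj "('x, 'f, 'r) form" "('x, 'f, 'r) form"
  | Disj "('x, 'f, 'r) form" "('x, 'f, 'r) form"
  | Impl "('x, 'f, 'r) form" "('x, 'f, 'r) form"
  | All 'x "('x, 'f, 'r) form"
  | Exi 'x "('x, 'f, 'r) form"

type_synonym ('x, 'd, 'm, 'i, 'u) valuation = "'x \<Rightarrow> ('d, 'm, 'i, 'u) val option"

record ('t, 'u, 'x, 'f, 'r, 'd, 'm, 'i) data_structure =
  other_type :: "'u \<Rightarrow> 't"
  var_type :: "'x \<Rightarrow> 't dtype"
  now :: 'x
  fun_args :: "'f \<Rightarrow> 't dtype list"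
  fun_res :: "'f \<Rightarrow> 't dtype"
  fun_int :: "'f \<Rightarrow> ('d, 'm, 'i, 'u) val list \<Rightarrow> ('d, 'm, 'i, 'u) val option"
  rel_args :: "'r \<Rightarrow> 't dtype list"
  rel_int :: "'r \<Rightarrow> ('d, 'm, 'i, 'u) val list \<Rightarrow> bool"

fun type_of ::
  "('t, 'u, 'x, 'f, 'r, 'd, 'm, 'i, 'z) data_structure_scheme \<Rightarrow> 
   ('d, 'm, 'i, 'u) val \<Rightarrow> 't dtype"
where
  "type_of D (VTime _) = TIME"
| "type_of D (VData _) = DATA"
| "type_of D (VMsg _) = MSG"
| "type_of D (VIP _) = IP"
| "type_of D (VIPs _) = IPSET"
| "type_of D (VOther u) = Other (other_type D u)"

definition wf_data where
  "wf_data D \<longleftrightarrow>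
     var_type D (now D) = TIME \<and>
     (\<forall>f vs v. map (type_of D) vs = fun_args D f \<longrightarrow> fun_int D f vs = Some v \<longrightarrow>
        type_of D v = fun_res D f)"

definition valuation ::
  "('t, 'u, 'x, 'f, 'r, 'd, 'm, 'i, 'z) data_structure_scheme \<Rightarrow> 
   ('x, 'd, 'm, 'i, 'u) valuation \<Rightarrow> bool"
where
  "valuation D \<xi> \<longleftrightarrow> (\<forall>x v. \<xi> x = Some v \<longrightarrow> type_of D v = var_type D x)"

fun expr_type where
  "expr_type D (Var x) = var_type D x"
| "expr_type D (Fn f es) = fun_res D f"

fun wt_expr where
  "wt_expr D (Var x) \<longleftrightarrow> True"
| "wt_expr D (Fn f es) \<longleftrightarrow>
     map (expr_type D) es = fun_args D f \<and> (\<forall>e \<in> set es. wt_expr D e)"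

definition has_type where
  "has_type D e t \<longleftrightarrow> wt_expr D e \<and> expr_type D e = t"

text \<open>\<open>None\<close> means undefined: a variable may have no value, a function may be partial,
  and undefinedness propagates from arguments to results.\<close>

fun expr_val ::
  "('t, 'u, 'x, 'f, 'r, 'd, 'm, 'i, 'z) data_structure_scheme \<Rightarrow> 
   ('x, 'd, 'm, 'i, 'u) valuation \<Rightarrow> ('x, 'f) expr \<Rightarrow> ('d, 'm, 'i, 'u) val option"
where
  "expr_val D \<xi> (Var x) = \<xi> x"
| "expr_val D \<xi> (Fn f es) = Option.bind (those (map (expr_val D \<xi>) es)) (fun_int D f)"

fun fv_expr where
  "fv_expr (Var x) = {x}"
| "fv_expr (Fn f es) = (\<Union>e \<in> set es. fv_expr e)"

primrec fv where
  "fv (Eq e1 e2) = fv_expr e1 \<union> fv_expr e2"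
| "fv (Rel r es) = (\<Union>e \<in> set es. fv_expr e)"
| "fv (Neg \<phi>) = fv \<phi>"
| "fv (Conj \<phi> \<psi>) = fv \<phi> \<union> fv \<psi>"
| "fv (Disj \<phi> \<psi>) = fv \<phi> \<union> fv \<psi>"
| "fv (Impl \<phi> \<psi>) = fv \<phi> \<union> fv \<psi>"
| "fv (All x \<phi>) = fv \<phi> - {x}"
| "fv (Exi x \<phi>) = fv \<phi> - {x}"

primrec wt_form where
  "wt_form D (Eq e1 e2) \<longleftrightarrow>
     wt_expr D e1 \<and> wt_expr D e2 \<and> expr_type D e1 = expr_type D e2"
| "wt_form D (Rel r es) \<longleftrightarrow> list_all2 (has_type D) es (rel_args D r)"
| "wt_form D (Neg \<phi>) \<longleftrightarrow> wt_form D \<phi>"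
| "wt_form D (Conj \<phi> \<psi>) \<longleftrightarrow> wt_form D \<phi> \<and> wt_form D \<psi>"
| "wt_form D (Disj \<phi> \<psi>) \<longleftrightarrow> wt_form D \<phi> \<and> wt_form D \<psi>"
| "wt_form D (Impl \<phi> \<psi>) \<longleftrightarrow> wt_form D \<phi> \<and> wt_form D \<psi>"
| "wt_form D (All x \<phi>) \<longleftrightarrow> wt_form D \<phi>"
| "wt_form D (Exi x \<phi>) \<longleftrightarrow> wt_form D \<phi>"

text \<open>An atomic formula with an undefined subterm is false; quantifiers range over the
  (defined) values of the type of the bound variable.\<close>

primrec sat ::
  "('t, 'u, 'x, 'f, 'r, 'd, 'm, 'i, 'z) data_structure_scheme \<Rightarrow> 
   ('x, 'd, 'm, 'i, 'u) valuation \<Rightarrow> ('x, 'f, 'r) form \<Rightarrow> bool"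
where
  "sat D \<xi> (Eq e1 e2) \<longleftrightarrow> (\<exists>v. expr_val D \<xi> e1 = Some v \<and> expr_val D \<xi> e2 = Some v)"
| "sat D \<xi> (Rel r es) \<longleftrightarrow> (\<exists>vs. those (map (expr_val D \<xi>) es) = Some vs \<and> rel_int D r vs)"
| "sat D \<xi> (Neg \<phi>) \<longleftrightarrow> \<not> sat D \<xi> \<phi>"
| "sat D \<xi> (Conj \<phi> \<psi>) \<longleftrightarrow> sat D \<xi> \<phi> \<and> sat D \<xi> \<psi>"
| "sat D \<xi> (Disj \<phi> \<psi>) \<longleftrightarrow> sat D \<xi> \<phi> \<or> sat D \<xi> \<psi>"
| "sat D \<xi> (Impl \<phi> \<psi>) \<longleftrightarrow> (sat D \<xi> \<phi> \<longrightarrow> sat D \<xi> \<psi>)"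
| "sat D \<xi> (All x \<phi>) \<longleftrightarrow> (\<forall>v. type_of D v = var_type D x \<longrightarrow> sat D (\<xi>(x \<mapsto> v)) \<phi>)"
| "sat D \<xi> (Exi x \<phi>) \<longleftrightarrow> (\<exists>v. type_of D v = var_type D x \<and> sat D (\<xi>(x \<mapsto> v)) \<phi>)"

definition guard_ext where
  "guard_ext D \<xi> \<phi> \<zeta> \<longleftrightarrow>
     valuation D \<zeta> \<and> \<xi> \<subseteq>\<^sub>m \<zeta> \<and> dom \<zeta> \<subseteq> dom \<xi> \<union> fv \<phi> \<and> sat D \<zeta> \<phi>"

text \<open>The body of a process call is run in a valuation that is defined on the formal
  parameters only, so \<open>now\<close> may have no value. Incrementing it then leaves it undefined;
  it does not block the passage of time.\<close>

definition tick where
  "tick D \<xi> = (case \<xi> (now D) of Some (VTime t) \<Rightarrow> \<xi>(now D \<mapsto> VTime (time_succ t)) | _ \<Rightarrow> \<xi>)"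


section \<open>Sequential processes\<close>

datatype ('x, 'f) prefix =
    Broadcast "('x, 'f) expr"
  | Groupcast "('x, 'f) expr" "('x, 'f) expr"
  | Send "('x, 'f) expr"
  | Deliver "('x, 'f) expr"
  | Receive 'x

datatype ('x, 'f, 'r, 'm, 'i, 'p) proc =
    Call 'p "('x, 'f) expr list"
  | Guard "('x, 'f, 'r) form" "('x, 'f, 'r, 'm, 'i, 'p) proc"
  | Assign 'x "('x, 'f) expr" "('x, 'f, 'r, 'm, 'i, 'p) proc"
  | Choice "('x, 'f, 'r, 'm, 'i, 'p) proc" "('x, 'f, 'r, 'm, 'i, 'p) proc"
  | Prefix "('x, 'f) prefix" "('x, 'f, 'r, 'm, 'i, 'p) proc"
  | Unicast "('x, 'f) expr" "('x, 'f) expr"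
      "('x, 'f, 'r, 'm, 'i, 'p) proc" "('x, 'f, 'r, 'm, 'i, 'p) proc"
  | Cast "'i set" 'm nat nat
      "('x, 'f, 'r, 'm, 'i, 'p) proc" "('x, 'f, 'r, 'm, 'i, 'p) proc"

record ('t, 'u, 'x, 'f, 'r, 'd, 'm, 'i, 'p) tawn =
  "('t, 'u, 'x, 'f, 'r, 'd, 'm, 'i) data_structure" +
  LB :: nat
  LG :: nat
  LU :: nat
  DeltaB :: nat
  DeltaG :: nat
  DeltaU :: nat
  params :: "'p \<Rightarrow> 'x list"
  body :: "'p \<Rightarrow> ('x, 'f, 'r, 'm, 'i, 'p) proc"

fun wt_prefix where
  "wt_prefix S (Broadcast ms) \<longleftrightarrow> has_type S ms MSG"
| "wt_prefix S (Groupcast dests ms) \<longleftrightarrow> has_type S dests IPSET \<and> has_type S ms MSG"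
| "wt_prefix S (Send ms) \<longleftrightarrow> has_type S ms MSG"
| "wt_prefix S (Deliver d) \<longleftrightarrow> has_type S d DATA"
| "wt_prefix S (Receive x) \<longleftrightarrow> var_type S x = MSG"

primrec wt_proc ::
  "('t, 'u, 'x, 'f, 'r, 'd, 'm, 'i, 'p) tawn \<Rightarrow> 
   ('x, 'f, 'r, 'm, 'i, 'p) proc \<Rightarrow> bool"
where
  "wt_proc S (Call X es) \<longleftrightarrow> list_all2 (\<lambda>e x. has_type S e (var_type S x)) es (params S X)"
| "wt_proc S (Guard \<phi> p) \<longleftrightarrow> wt_form S \<phi> \<and> wt_proc S p"
| "wt_proc S (Assign x e p) \<longleftrightarrow> has_type S e (var_type S x) \<and> wt_proc S p"
| "wt_proc S (Choice p q) \<longleftrightarrow> wt_proc S p \<and> wt_proc S q"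
| "wt_proc S (Prefix \<alpha> p) \<longleftrightarrow> wt_prefix S \<alpha> \<and> wt_proc S p"
| "wt_proc S (Unicast dest ms p q) \<longleftrightarrow>
     has_type S dest IP \<and> has_type S ms MSG \<and> wt_proc S p \<and> wt_proc S q"
| "wt_proc S (Cast dsts m n k p q) \<longleftrightarrow> wt_proc S p \<and> wt_proc S q"

primrec cast_free where
  "cast_free (Call X es) \<longleftrightarrow> True"
| "cast_free (Guard \<phi> p) \<longleftrightarrow> cast_free p"
| "cast_free (Assign x e p) \<longleftrightarrow> cast_free p"
| "cast_free (Choice p q) \<longleftrightarrow> cast_free p \<and> cast_free q"
| "cast_free (Prefix \<alpha> p) \<longleftrightarrow> cast_free p"
| "cast_free (Unicast dest ms p q) \<longleftrightarrow> cast_free p \<and> cast_free q"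
| "cast_free (Cast dsts m n k p q) \<longleftrightarrow> False"

primrec no_cast_in_choice where
  "no_cast_in_choice (Call X es) \<longleftrightarrow> True"
| "no_cast_in_choice (Guard \<phi> p) \<longleftrightarrow> no_cast_in_choice p"
| "no_cast_in_choice (Assign x e p) \<longleftrightarrow> no_cast_in_choice p"
| "no_cast_in_choice (Choice p q) \<longleftrightarrow> cast_free p \<and> cast_free q"
| "no_cast_in_choice (Prefix \<alpha> p) \<longleftrightarrow> no_cast_in_choice p"
| "no_cast_in_choice (Unicast dest ms p q) \<longleftrightarrow> no_cast_in_choice p \<and> no_cast_in_choice q"
| "no_cast_in_choice (Cast dsts m n k p q) \<longleftrightarrow> no_cast_in_choice p \<and> no_cast_in_choice q"

text \<open>\<open>Choice\<close> and the auxiliary \<open>Cast\<close> do not guard the calls below them.\<close>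

primrec guarded where
  "guarded (Call X es) \<longleftrightarrow> False"
| "guarded (Guard \<phi> p) \<longleftrightarrow> True"
| "guarded (Assign x e p) \<longleftrightarrow> True"
| "guarded (Choice p q) \<longleftrightarrow> guarded p \<and> guarded q"
| "guarded (Prefix \<alpha> p) \<longleftrightarrow> True"
| "guarded (Unicast dest ms p q) \<longleftrightarrow> True"
| "guarded (Cast dsts m n k p q) \<longleftrightarrow> guarded p \<and> guarded q"

definition wf_tawn where
  "wf_tawn S \<longleftrightarrow>
     wf_data S \<and> LB S > 0 \<and> LG S > 0 \<and> LU S > 0 \<and>
     (\<forall>X. wt_proc S (body S X) \<and> no_cast_in_choice (body S X) \<and> guarded (body S X))"

type_synonym ('u, 'x, 'f, 'r, 'd, 'm, 'i, 'p) state =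
  "('x, 'd, 'm, 'i, 'u) valuation \<times> ('x, 'f, 'r, 'm, 'i, 'p) proc"

definition wf_state ::
  "('t, 'u, 'x, 'f, 'r, 'd, 'm, 'i, 'p) tawn \<Rightarrow> 
   ('u, 'x, 'f, 'r, 'd, 'm, 'i, 'p) state \<Rightarrow> bool"
where
  "wf_state S P \<longleftrightarrow> valuation S (fst P) \<and> wt_proc S (snd P) \<and> no_cast_in_choice (snd P)"


section \<open>Transitions\<close>

text \<open>The wait actions w, wr, ws, wrs.\<close>

datatype wait = W | WR | WS | WRS

fun wait_join :: "wait \<Rightarrow> wait \<Rightarrow> wait" where
  "wait_join W x = x"
| "wait_join x W = x"
| "wait_join WR WR = WR"
| "wait_join WS WS = WS"
| "wait_join _ _ = WRS"

text \<open>\<open>ACast R m\<close> is the action \<open>R:*cast(m)\<close> and \<open>ATransmit R w\<close> the transmission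
  action \<open>R:w\<close>.\<close>

datatype ('d, 'm, 'i) act =
    Tau
  | ACast "'i set" 'm
  | ASend 'm
  | ADeliver 'd
  | AReceive 'm
  | AWait wait
  | ATransmit "'i set" wait

fun unvalued ::
  "('t, 'u, 'x, 'f, 'r, 'd, 'm, 'i, 'p) tawn \<Rightarrow> 
   ('x, 'd, 'm, 'i, 'u) valuation \<Rightarrow> ('x, 'f, 'r, 'm, 'i, 'p) proc \<Rightarrow> bool"
where
  "unvalued S \<xi> (Prefix (Broadcast ms) p) \<longleftrightarrow> expr_val S \<xi> ms = None"
| "unvalued S \<xi> (Prefix (Groupcast dests ms) p) \<longleftrightarrow>
     expr_val S \<xi> dests = None \<or> expr_val S \<xi> ms = None"
| "unvalued S \<xi> (Prefix (Send ms) p) \<longleftrightarrow> expr_val S \<xi> ms = None"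
| "unvalued S \<xi> (Prefix (Deliver d) p) \<longleftrightarrow> expr_val S \<xi> d = None"
| "unvalued S \<xi> (Unicast dest ms p q) \<longleftrightarrow> expr_val S \<xi> dest = None \<or> expr_val S \<xi> ms = None"
| "unvalued S \<xi> (Assign x e p) \<longleftrightarrow> expr_val S \<xi> e = None"
| "unvalued S \<xi> (Call X es) \<longleftrightarrow> (\<exists>e \<in> set es. expr_val S \<xi> e = None)"
| "unvalued S \<xi> _ \<longleftrightarrow> False"

inductive step ::
  "('t, 'u, 'x, 'f, 'r, 'd, 'm, 'i, 'p) tawn \<Rightarrow>
   ('u, 'x, 'f, 'r, 'd, 'm, 'i, 'p) state \<Rightarrow> ('d, 'm, 'i) act \<Rightarrow>
   ('u, 'x, 'f, 'r, 'd, 'm, 'i, 'p) state \<Rightarrow> bool"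
  for S :: "('t, 'u, 'x, 'f, 'r, 'd, 'm, 'i, 'p) tawn"
where
  broadcast:
    "expr_val S \<xi> ms = Some (VMsg m) \<Longrightarrow>
     step S (\<xi>, Prefix (Broadcast ms) p) Tau (\<xi>, Cast UNIV m (LB S) (DeltaB S) p p)"
| groupcast:
    "expr_val S \<xi> dests = Some (VIPs ds) \<Longrightarrow> expr_val S \<xi> ms = Some (VMsg m) \<Longrightarrow>
     step S (\<xi>, Prefix (Groupcast dests ms) p) Tau (\<xi>, Cast ds m (LG S) (DeltaG S) p p)"
| unicast:
    "expr_val S \<xi> dest = Some (VIP d) \<Longrightarrow> expr_val S \<xi> ms = Some (VMsg m) \<Longrightarrow>
     step S (\<xi>, Unicast dest ms p q) Tau (\<xi>, Cast {d} m (LU S) (DeltaU S) p q)"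
| transmit_n:
    "step S (\<xi>, Cast dsts m (n + 1) k p q) (ATransmit R W)
       (tick S \<xi>, Cast (dsts \<inter> R) m n k p q)"
| transmit_o:
    "step S (\<xi>, Cast dsts m (n + 1) (k + 1) p q) (ATransmit R W)
       (tick S \<xi>, Cast (dsts \<inter> R) m (n + 1) k p q)"
| complete_success:
    "dsts \<noteq> {} \<Longrightarrow> step S (\<xi>, Cast dsts m 0 k p q) (ACast dsts m) (\<xi>, p)"
| complete_failure:
    "dsts = {} \<Longrightarrow> step S (\<xi>, Cast dsts m 0 k p q) (ACast dsts m) (\<xi>, q)"
| send:
    "expr_val S \<xi> ms = Some (VMsg m) \<Longrightarrow> step S (\<xi>, Prefix (Send ms) p) (ASend m) (\<xi>, p)"
| send_wait:
    "expr_val S \<xi> ms = Some (VMsg m) \<Longrightarrow>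
     step S (\<xi>, Prefix (Send ms) p) (AWait WS) (tick S \<xi>, Prefix (Send ms) p)"
| deliver:
    "expr_val S \<xi> e = Some (VData d) \<Longrightarrow>
     step S (\<xi>, Prefix (Deliver e) p) (ADeliver d) (\<xi>, p)"
| receive:
    "step S (\<xi>, Prefix (Receive x) p) (AReceive m) (\<xi>(x \<mapsto> VMsg m), p)"
| receive_wait:
    "step S (\<xi>, Prefix (Receive x) p) (AWait WR) (tick S \<xi>, Prefix (Receive x) p)"
| assign:
    "expr_val S \<xi> e = Some v \<Longrightarrow> step S (\<xi>, Assign x e p) Tau (\<xi>(x \<mapsto> v), p)"
| stuck:
    "unvalued S \<xi> r \<Longrightarrow> step S (\<xi>, r) (AWait W) (tick S \<xi>, r)"
| call:
    "those (map (expr_val S \<xi>) es) = Some vs \<Longrightarrow>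
     step S (Map.empty(params S X [\<mapsto>] vs), body S X) a (\<zeta>, p') \<Longrightarrow>
     a \<notin> range AWait \<Longrightarrow>
     step S (\<xi>, Call X es) a (\<zeta>, p')"
| call_wait:
    "those (map (expr_val S \<xi>) es) = Some vs \<Longrightarrow>
     step S (Map.empty(params S X [\<mapsto>] vs), body S X) (AWait w1) (\<zeta>, p') \<Longrightarrow>
     step S (\<xi>, Call X es) (AWait w1) (tick S \<xi>, Call X es)"
| guard:
    "guard_ext S \<xi> \<phi> \<zeta> \<Longrightarrow> step S (\<xi>, Guard \<phi> p) Tau (\<zeta>, p)"
| guard_wait:
    "\<not> (\<exists>\<zeta>. guard_ext S \<xi> \<phi> \<zeta>) \<Longrightarrow>
     step S (\<xi>, Guard \<phi> p) (AWait W) (tick S \<xi>, Guard \<phi> p)"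
| choice_left:
    "step S (\<xi>, p) a (\<zeta>, p') \<Longrightarrow> a \<notin> range AWait \<Longrightarrow> step S (\<xi>, Choice p q) a (\<zeta>, p')"
| choice_right:
    "step S (\<xi>, p) a (\<zeta>, p') \<Longrightarrow> a \<notin> range AWait \<Longrightarrow> step S (\<xi>, Choice q p) a (\<zeta>, p')"
| choice_wait:
    "step S (\<xi>, p) (AWait w1) (\<zeta>, p') \<Longrightarrow> step S (\<xi>, q) (AWait w2) (\<zeta>, q') \<Longrightarrow>
     step S (\<xi>, Choice p q) (AWait (wait_join w1 w2)) (\<zeta>, Choice p' q')"

definition can ::
  "('t, 'u, 'x, 'f, 'r, 'd, 'm, 'i, 'p) tawn \<Rightarrow> 
   ('u, 'x, 'f, 'r, 'd, 'm, 'i, 'p) state \<Rightarrow> ('d, 'm, 'i) act \<Rightarrow> bool"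
where
  "can S P a \<longleftrightarrow> (\<exists>P'. step S P a P')"

definition can_rcv ::
  "('t, 'u, 'x, 'f, 'r, 'd, 'm, 'i, 'p) tawn \<Rightarrow> 
   ('u, 'x, 'f, 'r, 'd, 'm, 'i, 'p) state \<Rightarrow> bool"
where
  "can_rcv S P \<longleftrightarrow> (\<exists>m. can S P (AReceive m))"

definition can_send ::
  "('t, 'u, 'x, 'f, 'r, 'd, 'm, 'i, 'p) tawn \<Rightarrow> 
   ('u, 'x, 'f, 'r, 'd, 'm, 'i, 'p) state \<Rightarrow> bool"
where
  "can_send S P \<longleftrightarrow> (\<exists>m. can S P (ASend m))"

definition can_other ::
  "('t, 'u, 'x, 'f, 'r, 'd, 'm, 'i, 'p) tawn \<Rightarrow> 
   ('u, 'x, 'f, 'r, 'd, 'm, 'i, 'p) state \<Rightarrow> bool"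
where
  "can_other S P \<longleftrightarrow> (\<exists>a. a \<notin> range AReceive \<union> range ASend \<union> range AWait \<and> can S P a)"

end

theory Submission
  imports Defs
begin

text \<open>The four equivalences together say that the wait actions of a state are a function of the
  remaining ones: it waits iff it has no \<open>other\<close> action, and then with exactly one \<open>w\<close>,
  determined by whether it can receive and whether it can send. This property is compositional:
  choice takes the union of the non-wait actions and the join of the wait actions. A call has the
  actions of the body, so the calls are handled by first doing the guarded expressions,
  whose induction never reaches a call. Typing excludes the remaining possible deadlocks, namely
  expressions that are defined but have a value of the wrong kind.\<close>

text \<open>Membership bits for the subsets of {receive, send}: under this encoding
  \<open>wait_join\<close> is union of subsets.\<close>

definition wait_of :: "bool \<Rightarrow> bool \<Rightarrow> wait" where
  "wait_of r s = (if r then if s then WRS else WR else if s then WS else W)"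

definition wait_law ::
  "('t, 'u, 'x, 'f, 'r, 'd, 'm, 'i, 'p) tawn \<Rightarrow>
   ('u, 'x, 'f, 'r, 'd, 'm, 'i, 'p) state \<Rightarrow> bool"
where
  "wait_law S P \<longleftrightarrow>
     (\<forall>w. can S P (AWait w) \<longleftrightarrow> \<not> can_other S P \<and> w = wait_of (can_rcv S P) (can_send S P))"

lemma wait_join_wait_of: "wait_join (wait_of r s) (wait_of r' s') = wait_of (r \<or> r') (s \<or> s')"
  by (cases r; cases s; cases r'; cases s'; simp add: wait_of_def)

lemma canI: "step S P a P' \<Longrightarrow> can S P a"
  unfolding can_def by blast

lemma canE:
  assumes "can S P a"
  obtains \<zeta> p' where "step S P a (\<zeta>, p')"
  using assms by (auto simp: can_def)

text \<open>Only the enabled labels matter, not the targets. This lets a call inherit the law from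
  its body although \<open>call_wait\<close> replaces the target.\<close>

lemma wait_law_cong:
  assumes "\<And>a. can S P a \<longleftrightarrow> can S Q a"
  shows "wait_law S P \<longleftrightarrow> wait_law S Q"
  using assms by (simp add: wait_law_def can_rcv_def can_send_def can_other_def)

lemma wait_law_only_wait: "(\<And>a. can S P a \<longleftrightarrow> a = AWait W) \<Longrightarrow> wait_law S P"
  by (auto simp: wait_law_def can_rcv_def can_send_def can_other_def wait_of_def)

lemma wait_law_other:
  assumes "can S P a" and "a \<notin> range AReceive \<union> range ASend \<union> range AWait"
    and "\<And>w. \<not> can S P (AWait w)"
  shows "wait_law S P"
  using assms unfolding wait_law_def can_other_def by blast


subsection \<open>Well-typed evaluation\<close>

lemma those_Some_iff: "those xs = Some ys \<longleftrightarrow> xs = map Some ys"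
proof (induction xs arbitrary: ys)
  case Nil
  then show ?case by auto
next
  case (Cons x xs)
  then show ?case by (cases x; cases ys) auto
qed

lemma those_None_iff: "those xs = None \<longleftrightarrow> None \<in> set xs"
  by (induction xs) (auto split: option.splits)

lemma type_of_expr_val:
  assumes "wf_data S" and "valuation S \<xi>"
  shows "wt_expr S e \<Longrightarrow> expr_val S \<xi> e = Some v \<Longrightarrow> type_of S v = expr_type S e"
proof (induction e arbitrary: v)
  case (Var x)
  then show ?case using assms by (simp add: valuation_def)
next
  case (Fn f es)
  then obtain vs where vs: "map (expr_val S \<xi>) es = map Some vs" and v: "fun_int S f vs = Some v"
    by (auto simp: those_Some_iff bind_eq_Some_conv)
  have len: "length es = length vs"
    using vs map_eq_imp_length_eq by blast
  \<comment> \<open>\<open>wf_data\<close> fixes the result type of \<open>f\<close> only on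
    well-typed arguments, so the argument types come first.\<close>
  have "type_of S (vs ! i) = expr_type S (es ! i)" if "i < length es" for i
  proof -
    have "expr_val S \<xi> (es ! i) = Some (vs ! i)"
      using vs that len by (metis nth_map)
    then show ?thesis
      using Fn.IH[of "es ! i"] Fn.prems(1) that by simp
  qed
  then have "map (type_of S) vs = map (expr_type S) es"
    using len by (simp add: list_eq_iff_nth_eq)
  then have "map (type_of S) vs = fun_args S f"
    using Fn.prems(1) by simp
  then show ?case
    using v assms(1) by (simp add: wf_data_def)
qed

lemma expr_val_typed:
  assumes "wf_data S" and "valuation S \<xi>" and "has_type S e t" and "expr_val S \<xi> e = Some v"
  shows "type_of S v = t"
  using assms type_of_expr_val by (fastforce simp: has_type_def)

text \<open>Closes the gap between \<open>unvalued\<close>, which tests only for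
  \<open>None\<close>, and the transition rules, which demand a particular constructor of the value:
  for these types \<open>type_of\<close> determines the constructor.\<close>

lemma expr_val_cases:
  assumes "wf_data S" and "valuation S \<xi>" and "expr_val S \<xi> e \<noteq> None"
  shows "has_type S e DATA \<Longrightarrow> \<exists>d. expr_val S \<xi> e = Some (VData d)"
    and "has_type S e MSG \<Longrightarrow> \<exists>m. expr_val S \<xi> e = Some (VMsg m)"
    and "has_type S e IP \<Longrightarrow> \<exists>i. expr_val S \<xi> e = Some (VIP i)"
    and "has_type S e IPSET \<Longrightarrow> \<exists>ds. expr_val S \<xi> e = Some (VIPs ds)"
proof -
  obtain v where v: "expr_val S \<xi> e = Some v"
    using assms(3) by blast
  note t = expr_val_typed[OF assms(1,2) _ v]
  show "has_type S e DATA \<Longrightarrow> \<exists>d. expr_val S \<xi> e = Some (VData d)"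
    and "has_type S e MSG \<Longrightarrow> \<exists>m. expr_val S \<xi> e = Some (VMsg m)"
    and "has_type S e IP \<Longrightarrow> \<exists>i. expr_val S \<xi> e = Some (VIP i)"
    and "has_type S e IPSET \<Longrightarrow> \<exists>ds. expr_val S \<xi> e = Some (VIPs ds)"
    unfolding v by (drule t, cases v; simp)+
qed

text \<open>The arguments are evaluated in the caller's \<open>\<xi>\<close>; \<open>\<zeta>\<close>
  stays arbitrary because it accumulates the parameters assigned so far, starting from
  \<open>Map.empty\<close> in a call.\<close>

lemma valuation_params:
  assumes "wf_data S" and "valuation S \<xi>"
    and "list_all2 (\<lambda>e x. has_type S e (var_type S x)) es xs"
    and "map (expr_val S \<xi>) es = map Some vs"
    and "valuation S \<zeta>"
  shows "valuation S (\<zeta>(xs [\<mapsto>] vs))"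
  using assms(3-5)
proof (induction arbitrary: vs \<zeta> rule: list_all2_induct)
  case Nil
  then show ?case by simp
next
  case (Cons e es x xs)
  then obtain v ws where vs: "vs = v # ws" "expr_val S \<xi> e = Some v"
      "map (expr_val S \<xi>) es = map Some ws"
    by (cases vs) auto
  have "type_of S v = var_type S x"
    using expr_val_typed[OF assms(1,2) Cons.hyps(1) vs(2)] .
  then have "valuation S (\<zeta>(x \<mapsto> v))"
    using Cons.prems by (simp add: valuation_def)
  then show ?case
    using Cons.IH[OF vs(3)] vs(1) by simp
qed


subsection \<open>The actions of each process construct\<close>

inductive_cases step_PrefixE: "step S (\<xi>, Prefix \<alpha> p) a P'"
inductive_cases step_UnicastE: "step S (\<xi>, Unicast dest ms p q) a P'"
inductive_cases step_CastE: "step S (\<xi>, Cast dsts m n k p q) a P'"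
inductive_cases step_AssignE: "step S (\<xi>, Assign x e p) a P'"
inductive_cases step_GuardE: "step S (\<xi>, Guard \<phi> p) a P'"
inductive_cases step_CallE: "step S (\<xi>, Call X es) a P'"
inductive_cases step_ChoiceE: "step S (\<xi>, Choice p q) a P'"

lemma unvalued_Call_iff: "unvalued S \<xi> (Call X es) \<longleftrightarrow> those (map (expr_val S \<xi>) es) = None"
  by (auto simp: those_None_iff image_iff eq_commute[of None])

text \<open>Every other rule for these constructs requires the displayed expressions to be defined,
  so only \<open>stuck\<close> remains.\<close>

lemma can_unvalued:
  assumes "unvalued S \<xi> r"
  shows "can S (\<xi>, r) a \<longleftrightarrow> a = AWait W"
proof
  assume "can S (\<xi>, r) a"
  then obtain P' where "step S (\<xi>, r) a P'"
    by (auto simp: can_def)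
  then show "a = AWait W"
    \<comment> \<open>Rewriting calls by \<open>unvalued_Call_iff\<close> makes them contradict the
      \<open>those\<close> premise of \<open>call\<close> and \<open>call_wait\<close>.\<close>
    using assms by cases (auto simp: unvalued_Call_iff simp del: unvalued.simps(7))
next
  assume "a = AWait W"
  then show "can S (\<xi>, r) a"
    using assms stuck can_def by blast
qed

text \<open>\<open>call\<close> covers the non-wait labels of the body and \<open>call_wait\<close>
  the wait labels, both keeping the label; defined arguments exclude \<open>stuck\<close>.\<close>

lemma can_Call:
  assumes "those (map (expr_val S \<xi>) es) = Some vs"
  shows "can S (\<xi>, Call X es) a \<longleftrightarrow> can S (Map.empty(params S X [\<mapsto>] vs), body S X) a"
proof
  assume "can S (\<xi>, Call X es) a"
  then obtain P' where "step S (\<xi>, Call X es) a P'"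
    by (auto simp: can_def)
  moreover have "\<not> unvalued S \<xi> (Call X es)"
    using assms unvalued_Call_iff by (metis option.distinct(1))
  ultimately show "can S (Map.empty(params S X [\<mapsto>] vs), body S X) a"
    using assms by (elim step_CallE) (auto intro: canI)
next
  assume "can S (Map.empty(params S X [\<mapsto>] vs), body S X) a"
  then show "can S (\<xi>, Call X es) a"
    using call[OF assms] call_wait[OF assms]
    by (cases "a \<in> range AWait") (blast elim: canE intro: canI)+
qed

lemma can_Choice:
  assumes "a \<notin> range AWait"
  shows "can S (\<xi>, Choice p q) a \<longleftrightarrow> can S (\<xi>, p) a \<or> can S (\<xi>, q) a"
proof
  assume "can S (\<xi>, Choice p q) a"
  then obtain P' where "step S (\<xi>, Choice p q) a P'"
    by (auto simp: can_def)
  then show "can S (\<xi>, p) a \<or> can S (\<xi>, q) a"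
    using assms by cases (auto intro: canI)
next
  assume "can S (\<xi>, p) a \<or> can S (\<xi>, q) a"
  then show "can S (\<xi>, Choice p q) a"
    using assms by (elim disjE canE) (rule canI, erule (1) choice_left choice_right)+
qed

text \<open>Supplies the common target valuation that \<open>choice_wait\<close> demands of its two
  branches.\<close>

lemma step_wait_tick:
  assumes "step S P a P'" and "a \<in> range AWait"
  shows "fst P' = tick S (fst P)"
  using assms by induction auto

lemma can_Choice_wait:
  "can S (\<xi>, Choice p q) (AWait w) \<longleftrightarrow>
     (\<exists>w1 w2. w = wait_join w1 w2 \<and> can S (\<xi>, p) (AWait w1) \<and> can S (\<xi>, q) (AWait w2))"
proof
  assume "can S (\<xi>, Choice p q) (AWait w)"
  then obtain P' where "step S (\<xi>, Choice p q) (AWait w) P'"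
    by (auto simp: can_def)
  then show "\<exists>w1 w2. w = wait_join w1 w2 \<and> can S (\<xi>, p) (AWait w1) \<and> can S (\<xi>, q) (AWait w2)"
    by cases (auto intro: canI)
next
  assume "\<exists>w1 w2. w = wait_join w1 w2 \<and> can S (\<xi>, p) (AWait w1) \<and> can S (\<xi>, q) (AWait w2)"
  then show "can S (\<xi>, Choice p q) (AWait w)"
    by (elim exE conjE canE) (metis canI choice_wait step_wait_tick fst_conv rangeI)
qed

text \<open>Each branch has at most one wait action, so the join in \<open>can_Choice_wait\<close>
  is forced; \<open>wait_join_wait_of\<close> matches it with the united capabilities.\<close>

lemma wait_law_Choice:
  assumes "wait_law S (\<xi>, p)" and "wait_law S (\<xi>, q)"
  shows "wait_law S (\<xi>, Choice p q)"
proof -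
  have "can_rcv S (\<xi>, Choice p q) \<longleftrightarrow> can_rcv S (\<xi>, p) \<or> can_rcv S (\<xi>, q)"
    "can_send S (\<xi>, Choice p q) \<longleftrightarrow> can_send S (\<xi>, p) \<or> can_send S (\<xi>, q)"
    "can_other S (\<xi>, Choice p q) \<longleftrightarrow> can_other S (\<xi>, p) \<or> can_other S (\<xi>, q)"
    by (simp add: can_rcv_def can_Choice image_iff ex_disj_distrib,
        simp add: can_send_def can_Choice image_iff ex_disj_distrib,
        unfold can_other_def, use can_Choice in blast)
  then show ?thesis
    using assms unfolding wait_law_def can_Choice_wait by (auto simp: wait_join_wait_of)
qed

lemma wait_law_Guard: "wait_law S (\<xi>, Guard \<phi> p)"
proof (cases "\<exists>\<zeta>. guard_ext S \<xi> \<phi> \<zeta>")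
  case True
  show ?thesis
    by (rule wait_law_other[of _ _ Tau])
      (use True in \<open>auto simp: can_def intro: guard elim!: step_GuardE\<close>)
next
  case False
  show ?thesis
    by (rule wait_law_only_wait)
      (use False in \<open>auto simp: can_def intro: guard_wait elim!: step_GuardE\<close>)
qed

lemma wait_law_Assign: "wait_law S (\<xi>, Assign x e p)"
proof (cases "expr_val S \<xi> e")
  case None
  then show ?thesis by (intro wait_law_only_wait can_unvalued) simp
next
  case (Some v)
  show ?thesis
    by (rule wait_law_other[of _ _ Tau])
      (use Some in \<open>auto simp: can_def intro: assign elim!: step_AssignE\<close>)
qed

text \<open>Time passes here only through \<open>ATransmit\<close>, which counts as other.
  Completion is enabled when \<open>n\<close> is 0, transmission otherwise.\<close>

lemma wait_law_Cast: "wait_law S (\<xi>, Cast dsts m n k p q)"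
proof -
  have no_wait: "\<not> can S (\<xi>, Cast dsts m n k p q) (AWait w)" for w
    unfolding can_def by (auto elim: step_CastE)
  show ?thesis
  proof (cases n)
    case 0
    have "can S (\<xi>, Cast dsts m n k p q) (ACast dsts m)"
      unfolding 0
      by (cases "dsts = {}") (rule canI, erule complete_failure complete_success)+
    then show ?thesis
      using no_wait by (auto intro: wait_law_other)
  next
    case (Suc n')
    \<comment> \<open>Any \<open>R\<close> would serve as well as \<open>UNIV\<close>;
      \<open>transmit_n\<close> applies whatever the value of \<open>k\<close>.\<close>
    then have "can S (\<xi>, Cast dsts m n k p q) (ATransmit UNIV W)"
      using canI[OF transmit_n] by simp
    then show ?thesis
      using no_wait by (auto intro: wait_law_other)
  qed
qed

lemma wait_law_Unicast:
  assumes "wf_data S" and "valuation S \<xi>" and "has_type S dest IP" and "has_type S ms MSG"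
  shows "wait_law S (\<xi>, Unicast dest ms p q)"
proof (cases "unvalued S \<xi> (Unicast dest ms p q)")
  case True
  then show ?thesis by (intro wait_law_only_wait can_unvalued)
next
  case False
  then obtain d m where "expr_val S \<xi> dest = Some (VIP d)" "expr_val S \<xi> ms = Some (VMsg m)"
    using expr_val_cases[OF assms(1,2)] assms(3,4) unvalued.simps(5) by metis
  then show ?thesis
    by (intro wait_law_other[OF canI[OF unicast]]) (auto simp: can_def elim: step_UnicastE)
qed

lemma wait_law_Prefix:
  assumes "wf_data S" and "valuation S \<xi>" and "wt_prefix S \<alpha>"
  shows "wait_law S (\<xi>, Prefix \<alpha> p)"
proof (cases "unvalued S \<xi> (Prefix \<alpha> p)")
  case True
  then show ?thesis by (intro wait_law_only_wait can_unvalued)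
next
  case valued: False
  note typed = expr_val_cases[OF assms(1,2)]
  show ?thesis
  proof (cases \<alpha>)
    case (Broadcast ms)
    then obtain m where "expr_val S \<xi> ms = Some (VMsg m)"
      using valued assms(3) typed(2) by auto
    then show ?thesis
      unfolding Broadcast
      by (intro wait_law_other[OF canI[OF broadcast]]) (auto simp: can_def elim: step_PrefixE)
  next
    case (Groupcast dests ms)
    then obtain ds m where "expr_val S \<xi> dests = Some (VIPs ds)" "expr_val S \<xi> ms = Some (VMsg m)"
      using valued assms(3) typed(4)[of dests] typed(2)[of ms] by auto
    then show ?thesis
      unfolding Groupcast
      by (intro wait_law_other[OF canI[OF groupcast]]) (auto simp: can_def elim: step_PrefixE)
  next
    case (Send ms)
    then obtain m where m: "expr_val S \<xi> ms = Some (VMsg m)"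
      using valued assms(3) typed(2) by auto
    \<comment> \<open>Sending coexists with waiting, so \<open>wait_law_other\<close> does not apply
      and the full set of labels is computed.\<close>
    have "can S (\<xi>, Prefix (Send ms) p) a \<longleftrightarrow> a = ASend m \<or> a = AWait WS" for a
    proof
      assume "can S (\<xi>, Prefix (Send ms) p) a"
      then show "a = ASend m \<or> a = AWait WS"
        using m unfolding can_def by (auto elim: step_PrefixE)
    next
      assume "a = ASend m \<or> a = AWait WS"
      then show "can S (\<xi>, Prefix (Send ms) p) a"
        using canI[OF send[OF m]] canI[OF send_wait[OF m]] by blast
    qed
    then show ?thesis
      unfolding Send
      by (auto simp: wait_law_def can_rcv_def can_send_def can_other_def wait_of_def)
  next
    case (Deliver e)
    then obtain d where "expr_val S \<xi> e = Some (VData d)"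
      using valued assms(3) typed(1) by auto
    then show ?thesis
      unfolding Deliver
      by (intro wait_law_other[OF canI[OF deliver]]) (auto simp: can_def elim: step_PrefixE)
  next
    case (Receive x)
    \<comment> \<open>The message type is inhabited, so \<open>range AReceive\<close> is nonempty
      and \<open>can_rcv\<close> follows.\<close>
    have "can S (\<xi>, Prefix (Receive x) p) a \<longleftrightarrow> a \<in> range AReceive \<or> a = AWait WR" for a
    proof
      assume "can S (\<xi>, Prefix (Receive x) p) a"
      then show "a \<in> range AReceive \<or> a = AWait WR"
        unfolding can_def by (auto elim: step_PrefixE)
    next
      assume "a \<in> range AReceive \<or> a = AWait WR"
      then show "can S (\<xi>, Prefix (Receive x) p) a"
        by (auto intro: canI[OF receive] canI[OF receive_wait])
    qed
    then show ?thesis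
      unfolding Receive
      by (auto simp: wait_law_def can_rcv_def can_send_def can_other_def wait_of_def)
  qed
qed


subsection \<open>Guarded and arbitrary expressions\<close>

text \<open>Serves both stages: the last assumption is vacuous for guarded \<open>p\<close> and
  provides the law for bodies otherwise. The induction descends only through \<open>Choice\<close>,
  which keeps \<open>\<xi>\<close>, so \<open>\<xi>\<close> can be fixed.\<close>

lemma wait_law_induct:
  assumes "wf_data S" and "valuation S \<xi>" and "wt_proc S p"
    and "\<And>X \<zeta>. \<not> guarded p \<Longrightarrow> valuation S \<zeta> \<Longrightarrow> wait_law S (\<zeta>, body S X)"
  shows "wait_law S (\<xi>, p)"
  using assms(3,4)
proof (induction p)
  case (Call X es)
  show ?case
  proof (cases "those (map (expr_val S \<xi>) es)")
    case None
    then show ?thesis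
      by (intro wait_law_only_wait can_unvalued) (simp only: unvalued_Call_iff)
  next
    case (Some vs)
    have "valuation S (Map.empty(params S X [\<mapsto>] vs))"
      using Call.prems(1) Some
      by (intro valuation_params[OF assms(1,2), of es]) (simp_all add: those_Some_iff valuation_def)
    then have "wait_law S (Map.empty(params S X [\<mapsto>] vs), body S X)"
      \<comment> \<open>A call is never guarded, so the law for bodies is available.\<close>
      using Call.prems(2) by simp
    then show ?thesis
      using wait_law_cong[OF can_Call[OF Some]] by blast
  qed
next
  case (Choice p q)
  \<comment> \<open>An unguarded branch makes the whole choice unguarded, so the assumption on
    bodies passes to both branches.\<close>
  have "wait_law S (\<xi>, p)"
    using Choice.prems by (intro Choice.IH(1)) simp_all
  moreover have "wait_law S (\<xi>, q)"
    using Choice.prems by (intro Choice.IH(2)) simp_all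
  ultimately show ?case
    by (rule wait_law_Choice)
qed (simp_all add: wait_law_Guard wait_law_Assign wait_law_Cast
      wait_law_Unicast[OF assms(1,2)] wait_law_Prefix[OF assms(1,2)])

lemma wait_law_wf_state:
  assumes "wf_tawn S" and "wf_state S P"
  shows "wait_law S P"
proof -
  obtain \<xi> p where P: "P = (\<xi>, p)" by (cases P)
  \<comment> \<open>First stage: bodies are guarded, so nothing about other bodies is assumed and no
    circularity arises.\<close>
  have body: "wait_law S (\<zeta>, body S X)" if "valuation S \<zeta>" for X \<zeta>
    by (rule wait_law_induct) (use assms(1) that in \<open>simp_all add: wf_tawn_def\<close>)
  show ?thesis
    unfolding P
    by (rule wait_law_induct) (use assms body in \<open>simp_all add: P wf_tawn_def wf_state_def\<close>)
qed

theorem theorem1: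
  fixes S :: "('t, 'u, 'x, 'f, 'r, 'd, 'm, 'i, 'p) tawn"
    and P :: "('u, 'x, 'f, 'r, 'd, 'm, 'i, 'p) state"
  assumes "wf_tawn S" and "wf_state S P"
  shows "(can S P (AWait W) \<longleftrightarrow> \<not> can_rcv S P \<and> \<not> can_send S P \<and> \<not> can_other S P) \<and>
         (can S P (AWait WR) \<longleftrightarrow> can_rcv S P \<and> \<not> can_send S P \<and> \<not> can_other S P) \<and>
         (can S P (AWait WS) \<longleftrightarrow> \<not> can_rcv S P \<and> can_send S P \<and> \<not> can_other S P) \<and>
         (can S P (AWait WRS) \<longleftrightarrow> can_rcv S P \<and> can_send S P \<and> \<not> can_other S P)"
  using wait_law_wf_state[OF assms] unfolding wait_law_def wait_of_def
  \<comment> \<open>Fixing both bits turns \<open>wait_of\<close> into one constant; distinctness of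
    the constructors of \<open>wait\<close> refutes the other three.\<close>
  by (cases "can_rcv S P"; cases "can_send S P") simp_all

end
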